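(* Let $p$ be a prime and let $\chi$ be a multiplicative arithmetic function (not identically zero). Let $k\in\mathbb{N}\cup\{\infty\}$ and $\mathbf{t}=(t_1,t_2,\dots)$ (with $t_j=0$ for $j>k$ when $k$ is finite) be the parameters of the local core of $\chi$ at $p$, and let $\{F_{k,n}(\mathbf{t})\}_{n\ge 0}$ be the sequence of generalized Fibonacci polynomials evaluated at $\mathbf{t}$. Then for all $n\ge 0$, $$F_{k,n}(\mathbf{t})=\chi(p^n).$$
   Context: A multiplicative arithmetic function is a function $\chi:\mathbb{N}_{\geq 1}\to\mathbb{C}$, not identically zero, with $\chi(mn)=\chi(m)\chi(n)$ whenever $\gcd(m,n)=1$ (so $\chi(1)=1$). Dirichlet convolution is $(\alpha*\beta)(n)=\sum_{d\mid n}\alpha(d)\beta(n/d)$, and $\chi^{-1}$ denotes the inverse of $\chi$ for convolution. Local core: for a prime $p$, the parameters of $\chi$ at $p$ are the numbers $t_j=-\chi^{-1}(p^j)$, $j\ge 1$. If there is a finite $k$ with $t_k\ne 0$ and $t_j=0$ for $j>k$, the local core of $\chi$ is the polynomial $X^k-t_1X^{k-1}-\dots-t_k$ (with $k=0$ if all $t_j=0$); if infinitely many $t_j$ are non-zero, then $k=\infty$ and the core is the corresponding power series $1-\sum_{j\ge1}t_jy^j$. Generalized Fibonacci polynomials: $F_{k,0}=1$ and, for $n\ge1$, $$F_{k,n}(t_1,\dots,t_k)=\sum_{\alpha}\binom{|\alpha|}{\alpha_1,\dots,\alpha_k}t_1^{\alpha_1}\cdots t_k^{\alpha_k},$$ the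 sum being over all $\alpha=(\alpha_1,\dots,\alpha_k)$ of non-negative integers with $\sum_j j\alpha_j=n$, where $|\alpha|=\sum_j\alpha_j$ and the coefficient is the multinomial coefficient. For $k=\infty$ one takes all finitely supported sequences $(\alpha_j)_{j\ge1}$ with $\sum_j j\alpha_j=n$ (so only $t_1,\dots,t_n$ occur). *)

theory Defs
  imports Complex_Main "HOL-Library.Extended_Nat" "HOL-Computational_Algebra.Primes"
begin

text \<open>
  Arithmetic functions live on the positive integers. They are represented as functions on
  \<^typ>\<open>nat\<close> whose value at \<open>0\<close> carries no information.
\<close>

definition multiplicative_arith :: "(nat \<Rightarrow> complex) \<Rightarrow> bool" where
  "multiplicative_arith f \<longleftrightarrow>
     (\<exists>n\<ge>1. f n \<noteq> 0) \<and>
     (\<forall>m\<ge>1. \<forall>n\<ge>1. coprime m n \<longrightarrow> f (m * n) = f m * f n)"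

definition dirichlet_conv :: "(nat \<Rightarrow> complex) \<Rightarrow> (nat \<Rightarrow> complex) \<Rightarrow> nat \<Rightarrow> complex" where
  "dirichlet_conv f g n = (\<Sum>d | d dvd n. f d * g (n div d))"

text \<open>
  The condition at \<open>0\<close> only fixes the junk value, which makes the inverse unique as a function
  on \<^typ>\<open>nat\<close>.
\<close>

definition dirichlet_inv :: "(nat \<Rightarrow> complex) \<Rightarrow> nat \<Rightarrow> complex" where
  "dirichlet_inv f =
     (THE g. g 0 = 0 \<and> (\<forall>n\<ge>1. dirichlet_conv f g n = (if n = 1 then 1 else 0)))"

lemma multiplicative_arith_1:
  assumes "multiplicative_arith f"
  shows "f 1 = 1"
proof -
  obtain n where n: "n \<ge> 1" "f n \<noteq> 0"
    using assms by (auto simp: multiplicative_arith_def)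
  have "f (1 * n) = f 1 * f n"
    using assms n(1) unfolding multiplicative_arith_def by (metis coprime_1_left order_refl)
  with n(2) show ?thesis by simp
qed

lemma dirichlet_conv_rec:
  assumes "n \<ge> 1"
  shows "dirichlet_conv f g n = f 1 * g n + (\<Sum>d | d dvd n \<and> d \<noteq> 1. f d * g (n div d))"
proof -
  have eq: "{d. d dvd n} = insert 1 {d. d dvd n \<and> d \<noteq> 1}" by auto
  have "finite {d. d dvd n \<and> d \<noteq> 1}"
    using assms by (auto intro: finite_subset[of _ "{d. d dvd n}"])
  then show ?thesis
    unfolding dirichlet_conv_def eq by simp
qed

function dirichlet_inv_rec :: "(nat \<Rightarrow> complex) \<Rightarrow> nat \<Rightarrow> complex" where
  "dirichlet_inv_rec f n = (if n = 0 then 0 else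
     ((if n = 1 then 1 else 0) -
        (\<Sum>d | d dvd n \<and> d \<noteq> 1. f d * dirichlet_inv_rec f (n div d))) / f 1)"
  by auto
termination
proof (relation "measure snd", goal_cases)
  case (2 f n d)
  then have "d \<noteq> 0" by (auto intro: ccontr)
  with 2 show ?case by auto
qed auto

declare dirichlet_inv_rec.simps [simp del]

lemma dirichlet_inv_ex1:
  assumes "f 1 \<noteq> 0"
  shows "\<exists>!g. g 0 = 0 \<and> (\<forall>n\<ge>1. dirichlet_conv f g n = (if n = 1 then 1 else 0))"
proof (rule ex1I[of _ "dirichlet_inv_rec f"], intro conjI allI impI)
  show "dirichlet_inv_rec f 0 = 0" by (simp add: dirichlet_inv_rec.simps)
next
  fix n :: nat
  assume "n \<ge> 1"
  then show "dirichlet_conv f (dirichlet_inv_rec f) n = (if n = 1 then 1 else 0)"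
    using assms by (simp add: dirichlet_conv_rec dirichlet_inv_rec.simps[of f n])
next
  fix g
  assume g: "g 0 = 0 \<and> (\<forall>n\<ge>1. dirichlet_conv f g n = (if n = 1 then 1 else 0))"
  have "g n = dirichlet_inv_rec f n" for n
  proof (induction n rule: less_induct)
    case (less n)
    show ?case
    proof (cases "n = 0")
      case True
      then show ?thesis using g by (simp add: dirichlet_inv_rec.simps)
    next
      case False
      have "(\<Sum>d | d dvd n \<and> d \<noteq> 1. f d * g (n div d)) =
            (\<Sum>d | d dvd n \<and> d \<noteq> 1. f d * dirichlet_inv_rec f (n div d))" (is "?S = ?T")
      proof (rule sum.cong)
        fix d assume d: "d \<in> {d. d dvd n \<and> d \<noteq> 1}"
        then have "d \<noteq> 0" using False by (auto intro: ccontr)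
        with d False have "n div d < n" by auto
        then show "f d * g (n div d) = f d * dirichlet_inv_rec f (n div d)"
          using less by simp
      qed simp
      moreover have "f 1 * g n + ?S = (if n = 1 then 1 else 0)"
        using g False dirichlet_conv_rec[of n f g] by auto
      ultimately have "f 1 * g n = (if n = 1 then 1 else 0) - ?T"
        by (simp add: eq_diff_eq)
      then show ?thesis
        using assms False
        by (subst dirichlet_inv_rec.simps) (simp add: eq_divide_eq mult.commute)
    qed
  qed
  then show "g = dirichlet_inv_rec f" by auto
qed

lemma dirichlet_conv_inv:
  assumes "multiplicative_arith f" "n \<ge> 1"
  shows "dirichlet_conv f (dirichlet_inv f) n = (if n = 1 then 1 else 0)"
proof -
  have "f 1 \<noteq> 0" using multiplicative_arith_1[OF assms(1)] by simp
  from theI'[OF dirichlet_inv_ex1[of f, OF this]] assms(2) show ?thesis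
    unfolding dirichlet_inv_def by blast
qed

text \<open>
  The local core with parameters \<open>k\<close> and \<open>t\<close> is the polynomial
  \<open>X\<^sup>k - t 1 X\<^sup>k\<^sup>-\<^sup>1 - \<dots> - t k\<close> if \<open>k\<close> is finite, and the power series \<open>1 - (\<Sum>j\<ge>1. t j y\<^sup>j)\<close>
  if \<open>k = \<infinity>\<close>. Parameters are indexed from \<open>1\<close>; \<open>t 0\<close> is unconstrained.
\<close>

definition local_core_params :: "(nat \<Rightarrow> complex) \<Rightarrow> nat \<Rightarrow> enat \<Rightarrow> (nat \<Rightarrow> complex) \<Rightarrow> bool" where
  "local_core_params f p k t \<longleftrightarrow>
     (\<forall>j\<ge>1. t j = - dirichlet_inv f (p ^ j)) \<and>
     (case k of
        enat m \<Rightarrow> (m \<noteq> 0 \<longrightarrow> t m \<noteq> 0) \<and> (\<forall>j>m. t j = 0)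
      | \<infinity> \<Rightarrow> infinite {j. j \<ge> 1 \<and> t j \<noteq> 0})"

lemma local_core_params_exists: "\<exists>k t. local_core_params f p k t"
proof -
  define t where "t = (\<lambda>j. - dirichlet_inv f (p ^ j))"
  define J where "J = {j. j \<ge> 1 \<and> t j \<noteq> 0}"
  show ?thesis
  proof (cases "finite J")
    case False
    then have "local_core_params f p \<infinity> t"
      by (simp add: local_core_params_def t_def J_def)
    then show ?thesis by blast
  next
    case True
    define m where "m = Max (insert 0 J)"
    have "m \<in> insert 0 J" unfolding m_def using True by (intro Max_in) auto
    moreover have "t j = 0" if "j > m" for j
    proof (rule ccontr)
      assume "t j \<noteq> 0"
      then have "j \<le> m" unfolding m_def using True that by (intro Max_ge) (auto simp: J_def)
      with that show False by simp
    qed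
    ultimately have "local_core_params f p (enat m) t"
      by (auto simp: local_core_params_def t_def J_def)
    then show ?thesis by blast
  qed
qed

text \<open>
  Exponent vectors are functions of finite support contained in the positive integers up to \<open>k\<close>;
  this covers \<open>k\<close> finite and \<open>k = \<infinity>\<close> uniformly.
\<close>

definition weighted_exponents :: "enat \<Rightarrow> nat \<Rightarrow> (nat \<Rightarrow> nat) set" where
  "weighted_exponents k n =
     {\<alpha>. finite {j. \<alpha> j \<noteq> 0} \<and> (\<forall>j. \<alpha> j \<noteq> 0 \<longrightarrow> 1 \<le> j \<and> enat j \<le> k) \<and>
         (\<Sum>j | \<alpha> j \<noteq> 0. j * \<alpha> j) = n}"

definition gen_fib :: "enat \<Rightarrow> nat \<Rightarrow> (nat \<Rightarrow> complex) \<Rightarrow> complex" where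
  "gen_fib k n t = (if n = 0 then 1 else
     (\<Sum>\<alpha>\<in>weighted_exponents k n.
        fact (\<Sum>j | \<alpha> j \<noteq> 0. \<alpha> j) / (\<Prod>j | \<alpha> j \<noteq> 0. fact (\<alpha> j)) *
        (\<Prod>j | \<alpha> j \<noteq> 0. t j ^ \<alpha> j)))"

lemma finite_weighted_exponents: "finite (weighted_exponents k n)"
proof (rule finite_subset)
  show "weighted_exponents k n \<subseteq> {\<alpha>. \<forall>j. (j \<in> {..n} \<longrightarrow> \<alpha> j \<in> {..n}) \<and> (j \<notin> {..n} \<longrightarrow> \<alpha> j = 0)}"
  proof (intro subsetI CollectI allI conjI impI)
    fix \<alpha> j
    assume \<alpha>: "\<alpha> \<in> weighted_exponents k n"
    have le: "j * \<alpha> j \<le> n \<and> 1 \<le> j" if "\<alpha> j \<noteq> 0" for j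
      using \<alpha> that member_le_sum[of j "{j. \<alpha> j \<noteq> 0}" "\<lambda>j. j * \<alpha> j"]
      by (auto simp: weighted_exponents_def)
    have "\<alpha> j \<le> n"
    proof (cases "\<alpha> j = 0")
      case False
      with le[of j] have "1 * \<alpha> j \<le> j * \<alpha> j" "j * \<alpha> j \<le> n" by (auto intro: mult_right_mono)
      then show ?thesis by linarith
    qed simp
    then show "\<alpha> j \<in> {..n}" by simp
    show "\<alpha> j = 0" if "j \<notin> {..n}"
    proof (rule ccontr)
      assume ne: "\<alpha> j \<noteq> 0"
      then have "j * 1 \<le> j * \<alpha> j" by (intro mult_left_mono) auto
      with le[OF ne] that show False by simp
    qed
  qed
  show "finite {\<alpha>. \<forall>j. (j \<in> {..n} \<longrightarrow> \<alpha> j \<in> {..n}) \<and> (j \<notin> {..n} \<longrightarrow> \<alpha> j = (0::nat))}"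
    by (rule finite_set_of_finite_funs) auto
qed

end

theory Submission
  imports Defs
begin

text \<open>
  Both sides equal \<open>1\<close> at \<open>0\<close> and satisfy the recursion \<open>a n = (\<Sum>j=1..n. t j * a (n - j))\<close>. For
  \<open>\<chi> (p ^ n)\<close> this is \<open>\<chi> * \<chi>\<inverse> = 1\<close> read off at \<open>p ^ n\<close>; for the Fibonacci polynomials it follows
  by applying the Pascal rule for multinomial coefficients to every monomial.
\<close>

text \<open>The summand of \<open>gen_fib\<close>. Writing the multinomial coefficient as a quotient
  of factorials in a field of characteristic 0 turns the Pascal rule into cancellation.\<close>

definition multinomial_term :: "('a \<Rightarrow> 'b::field_char_0) \<Rightarrow> ('a \<Rightarrow> nat) \<Rightarrow> 'b" where
  "multinomial_term t \<alpha> =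
     fact (\<Sum>j | \<alpha> j \<noteq> 0. \<alpha> j) / (\<Prod>j | \<alpha> j \<noteq> 0. fact (\<alpha> j)) * (\<Prod>j | \<alpha> j \<noteq> 0. t j ^ \<alpha> j)"

text \<open>Indices off the support add 0 to the sum and contribute factors \<open>fact 0\<close>
  and \<open>t j ^ 0\<close>, both 1. This allows an exponent vector and its decrement to be
  compared over one index set, although decrementing may shrink the support.\<close>

lemma multinomial_term_superset:
  assumes "finite A" "{j. \<alpha> j \<noteq> 0} \<subseteq> A"
  shows "multinomial_term t \<alpha> =
     fact (\<Sum>j\<in>A. \<alpha> j) / (\<Prod>j\<in>A. fact (\<alpha> j)) * (\<Prod>j\<in>A. t j ^ \<alpha> j)"
proof -
  have "(\<Sum>j | \<alpha> j \<noteq> 0. \<alpha> j) = (\<Sum>j\<in>A. \<alpha> j)"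
    by (rule sum.mono_neutral_left) (use assms in auto)
  moreover have "(\<Prod>j | \<alpha> j \<noteq> 0. fact (\<alpha> j)) = (\<Prod>j\<in>A. fact (\<alpha> j) :: 'b)"
    by (rule prod.mono_neutral_left) (use assms in auto)
  moreover have "(\<Prod>j | \<alpha> j \<noteq> 0. t j ^ \<alpha> j) = (\<Prod>j\<in>A. t j ^ \<alpha> j)"
    by (rule prod.mono_neutral_left) (use assms in auto)
  ultimately show ?thesis
    unfolding multinomial_term_def by simp
qed

text \<open>Lowering \<open>\<alpha> j\<close> removes a factor \<open>\<alpha> j\<close> from the
  denominator and a factor \<open>t j\<close> from the monomial. The result is the share
  \<open>\<alpha> j\<close> / |\<alpha>| of the term of \<alpha>.\<close>

lemma multinomial_term_decrement:
  assumes fin: "finite {i. \<alpha> i \<noteq> 0}" and j: "\<alpha> j \<noteq> 0"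
  shows "t j * multinomial_term t (\<alpha>(j := \<alpha> j - 1)) =
    of_nat (\<alpha> j) * (fact ((\<Sum>i | \<alpha> i \<noteq> 0. \<alpha> i) - 1) / (\<Prod>i | \<alpha> i \<noteq> 0. fact (\<alpha> i)) *
      (\<Prod>i | \<alpha> i \<noteq> 0. t i ^ \<alpha> i))"
proof -
  define A where "A = {i. \<alpha> i \<noteq> 0}"
  define \<beta> where "\<beta> = \<alpha>(j := \<alpha> j - 1)"
  have A: "finite A" "j \<in> A" using fin j by (auto simp: A_def)
  obtain m where m: "\<alpha> j = Suc m" using j by (cases "\<alpha> j") auto
  have \<beta>: "\<beta> j = m" "\<And>i. i \<in> A - {j} \<Longrightarrow> \<beta> i = \<alpha> i" by (auto simp: \<beta>_def m)
  have sum: "(\<Sum>i\<in>A. \<beta> i) = (\<Sum>i\<in>A. \<alpha> i) - 1"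
    unfolding sum.remove[OF A] using \<beta> m by simp
  have F: "(\<Prod>i\<in>A. fact (\<alpha> i) :: 'b) = of_nat (\<alpha> j) * (\<Prod>i\<in>A. fact (\<beta> i))"
    unfolding prod.remove[OF A] using \<beta> m by (simp add: mult.assoc)
  have T: "(\<Prod>i\<in>A. t i ^ \<alpha> i) = t j * (\<Prod>i\<in>A. t i ^ \<beta> i)"
    unfolding prod.remove[OF A] using \<beta> m by (simp add: mult.assoc)
  have "multinomial_term t \<beta> =
     fact (\<Sum>i\<in>A. \<beta> i) / (\<Prod>i\<in>A. fact (\<beta> i)) * (\<Prod>i\<in>A. t i ^ \<beta> i)"
    using A by (intro multinomial_term_superset) (auto simp: \<beta>_def A_def split: if_splits)
  moreover have "of_nat (\<alpha> j) \<noteq> (0 :: 'b)" using j by simp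
  ultimately show ?thesis
    unfolding A_def[symmetric] \<beta>_def[symmetric] sum F T by simp
qed

text \<open>By the preceding lemma each index j carries the share \<open>\<alpha> j\<close> /
  |\<alpha>| of the term, and these shares add up to 1.\<close>

lemma multinomial_term_pascal:
  assumes fin: "finite {j. \<alpha> j \<noteq> 0}" and "\<alpha> i \<noteq> 0"
  shows "multinomial_term t \<alpha> =
    (\<Sum>j | \<alpha> j \<noteq> 0. t j * multinomial_term t (\<alpha>(j := \<alpha> j - 1)))"
proof -
  define s where "s = (\<Sum>j | \<alpha> j \<noteq> 0. \<alpha> j)"
  \<comment> \<open>The factorial recursion used next fails at \<open>s = 0\<close>; this is where a
    nonzero exponent is required.\<close>
  have "s > 0"
    using assms member_le_sum[of i "{j. \<alpha> j \<noteq> 0}" \<alpha>] by (simp add: s_def)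
  then have fact_s: "fact s = (of_nat s * fact (s - 1) :: 'b)" by (rule fact_reduce)
  have "(\<Sum>j | \<alpha> j \<noteq> 0. t j * multinomial_term t (\<alpha>(j := \<alpha> j - 1))) =
    (\<Sum>j | \<alpha> j \<noteq> 0. of_nat (\<alpha> j) * (fact (s - 1) / (\<Prod>i | \<alpha> i \<noteq> 0. fact (\<alpha> i)) *
      (\<Prod>i | \<alpha> i \<noteq> 0. t i ^ \<alpha> i)))"
    unfolding s_def by (rule sum.cong[OF refl], rule multinomial_term_decrement[OF fin]) simp
  also have "\<dots> = of_nat s * (fact (s - 1) / (\<Prod>i | \<alpha> i \<noteq> 0. fact (\<alpha> i)) *
      (\<Prod>i | \<alpha> i \<noteq> 0. t i ^ \<alpha> i))"
    unfolding s_def of_nat_sum sum_distrib_right ..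
  also have "\<dots> = multinomial_term t \<alpha>"
    unfolding multinomial_term_def s_def[symmetric] fact_s by simp
  finally show ?thesis by simp
qed

lemma weighted_exponents_0: "weighted_exponents k 0 = {\<lambda>_. 0}"
  by (fastforce simp: weighted_exponents_def fun_eq_iff)

lemma weighted_exponents_increment:
  assumes "\<alpha> \<in> weighted_exponents k n" "1 \<le> j" "enat j \<le> k"
  shows "\<alpha>(j := Suc (\<alpha> j)) \<in> weighted_exponents k (n + j)"
proof -
  define A where "A = {i. \<alpha> i \<noteq> 0}"
  have A: "finite A" "(\<Sum>i\<in>A. i * \<alpha> i) = n" "\<forall>i\<in>A. 1 \<le> i \<and> enat i \<le> k"
    using assms(1) by (auto simp: weighted_exponents_def A_def)
  have supp: "{i. (\<alpha>(j := Suc (\<alpha> j))) i \<noteq> 0} = insert j A" by (auto simp: A_def)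
  have "(\<Sum>i\<in>insert j A. i * (\<alpha>(j := Suc (\<alpha> j))) i) = j * Suc (\<alpha> j) + (\<Sum>i\<in>A - {j}. i * \<alpha> i)"
    using A(1) by (simp add: sum.insert_remove)
  also have "\<dots> = j + (\<Sum>i\<in>insert j A. i * \<alpha> i)"
    using A(1) by (simp add: sum.insert_remove)
  \<comment> \<open>If j is outside the support, its extra summand is \<open>j * 0\<close>.\<close>
  also have "(\<Sum>i\<in>insert j A. i * \<alpha> i) = n"
    using A(1,2) by (cases "j \<in> A") (auto simp: insert_absorb A_def)
  finally show ?thesis
    unfolding weighted_exponents_def mem_Collect_eq supp using A assms(2,3)
    by (auto simp: A_def)
qed

lemma weighted_exponents_decrement:
  assumes "\<alpha> \<in> weighted_exponents k n" "\<alpha> j \<noteq> 0"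
  shows "j \<le> n" "\<alpha>(j := \<alpha> j - 1) \<in> weighted_exponents k (n - j)"
proof -
  define A where "A = {i. \<alpha> i \<noteq> 0}"
  define \<beta> where "\<beta> = \<alpha>(j := \<alpha> j - 1)"
  have A: "finite A" "j \<in> A" "(\<Sum>i\<in>A. i * \<alpha> i) = n" "\<forall>i\<in>A. 1 \<le> i \<and> enat i \<le> k"
    using assms by (auto simp: weighted_exponents_def A_def)
  obtain m where m: "\<alpha> j = Suc m" using assms(2) by (cases "\<alpha> j") auto
  have \<beta>: "\<beta> j = m" "\<And>i. i \<in> A - {j} \<Longrightarrow> \<beta> i = \<alpha> i" by (auto simp: \<beta>_def m)
  \<comment> \<open>Only an inclusion: j leaves the support when
    \<open>\<alpha> j = 1\<close>.\<close>
  have supp: "{i. \<beta> i \<noteq> 0} \<subseteq> A" by (auto simp: A_def \<beta>_def split: if_splits)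
  have "n = j + (\<Sum>i\<in>A. i * \<beta> i)"
    using A(1,2) \<beta> m unfolding A(3)[symmetric]
    by (simp add: sum.remove[of A j])
  also have "(\<Sum>i\<in>A. i * \<beta> i) = (\<Sum>i | \<beta> i \<noteq> 0. i * \<beta> i)"
    by (rule sum.mono_neutral_right) (use A(1) supp in auto)
  finally have n: "n = j + (\<Sum>i | \<beta> i \<noteq> 0. i * \<beta> i)" .
  then show "j \<le> n" by simp
  show "\<alpha>(j := \<alpha> j - 1) \<in> weighted_exponents k (n - j)"
    unfolding \<beta>_def[symmetric] weighted_exponents_def
    using n supp A(1,4) by (auto intro: finite_subset)
qed

text \<open>The separate value at \<open>n = 0\<close> agrees with the sum, since the zero vector is
  then the only exponent vector and its term is 1.\<close>

lemma gen_fib_eq: "gen_fib k n t = (\<Sum>\<alpha>\<in>weighted_exponents k n. multinomial_term t \<alpha>)"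
  by (cases "n = 0") (simp_all add: gen_fib_def multinomial_term_def weighted_exponents_0)

text \<open>The Pascal rule gives a sum over pairs of a vector \<alpha> and an index j in its
  support. Regrouping by j and the lowered vector, which has weight \<open>n - j\<close>, yields the
  recursion.\<close>

lemma gen_fib_rec:
  assumes n: "n \<ge> 1" and t: "\<And>j. k < enat j \<Longrightarrow> t j = 0"
  shows "gen_fib k n t = (\<Sum>j=1..n. t j * gen_fib k (n - j) t)"
proof -
  \<comment> \<open>The indices at which a vector of weight n can be lowered: the support is bounded
    by k, and an index in it cannot exceed the weight.\<close>
  define J where "J = {j\<in>{1..n}. enat j \<le> k}"
  have W: "finite {j. \<alpha> j \<noteq> 0}" "\<exists>i. \<alpha> i \<noteq> 0" if "\<alpha> \<in> weighted_exponents k n" for \<alpha>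
  proof -
    show "finite {j. \<alpha> j \<noteq> 0}" using that by (simp add: weighted_exponents_def)
    show "\<exists>i. \<alpha> i \<noteq> 0"
      using that n by (cases "\<exists>i. \<alpha> i \<noteq> 0") (simp_all add: weighted_exponents_def)
  qed
  have "gen_fib k n t = (\<Sum>\<alpha>\<in>weighted_exponents k n.
      \<Sum>j | \<alpha> j \<noteq> 0. t j * multinomial_term t (\<alpha>(j := \<alpha> j - 1)))"
    unfolding gen_fib_eq
  proof (rule sum.cong[OF refl])
    fix \<alpha> assume "\<alpha> \<in> weighted_exponents k n"
    with W obtain i where "finite {j. \<alpha> j \<noteq> 0}" "\<alpha> i \<noteq> 0" by blast
    then show "multinomial_term t \<alpha> =
        (\<Sum>j | \<alpha> j \<noteq> 0. t j * multinomial_term t (\<alpha>(j := \<alpha> j - 1)))"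
      by (rule multinomial_term_pascal)
  qed
  also have "\<dots> = (\<Sum>(\<alpha>, j)\<in>Sigma (weighted_exponents k n) (\<lambda>\<alpha>. {j. \<alpha> j \<noteq> 0}).
      t j * multinomial_term t (\<alpha>(j := \<alpha> j - 1)))"
    by (rule sum.Sigma) (use finite_weighted_exponents W(1) in auto)
  also have "\<dots> = (\<Sum>(j, \<beta>)\<in>Sigma J (\<lambda>j. weighted_exponents k (n - j)).
      t j * multinomial_term t \<beta>)"
  \<comment> \<open>Lowering and raising the exponent at j are mutually inverse.\<close>
  proof (rule sum.reindex_bij_witness[where j = "\<lambda>(\<alpha>, j). (j, \<alpha>(j := \<alpha> j - 1))"
        and i = "\<lambda>(j, \<beta>). (\<beta>(j := Suc (\<beta> j)), j)"])
    fix x assume "x \<in> Sigma (weighted_exponents k n) (\<lambda>\<alpha>. {j. \<alpha> j \<noteq> 0})"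
    then obtain \<alpha> j where x: "x = (\<alpha>, j)" and \<alpha>: "\<alpha> \<in> weighted_exponents k n" "\<alpha> j \<noteq> 0"
      by blast
    then have "1 \<le> j" "enat j \<le> k" by (simp_all add: weighted_exponents_def)
    with weighted_exponents_decrement[OF \<alpha>]
    show "(\<lambda>(\<alpha>, j). (j, \<alpha>(j := \<alpha> j - 1))) x \<in> Sigma J (\<lambda>j. weighted_exponents k (n - j))"
      by (simp add: x J_def)
  next
    fix y assume "y \<in> Sigma J (\<lambda>j. weighted_exponents k (n - j))"
    then obtain j \<beta> where y: "y = (j, \<beta>)" and "j \<in> J" and \<beta>: "\<beta> \<in> weighted_exponents k (n - j)"
      by blast
    then show "(\<lambda>(j, \<beta>). (\<beta>(j := Suc (\<beta> j)), j)) y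
        \<in> Sigma (weighted_exponents k n) (\<lambda>\<alpha>. {j. \<alpha> j \<noteq> 0})"
      using weighted_exponents_increment[OF \<beta>, of j] by (simp add: y J_def)
  qed auto
  also have "\<dots> = (\<Sum>j\<in>J. t j * gen_fib k (n - j) t)"
    by (subst sum.Sigma[symmetric])
      (auto simp: J_def finite_weighted_exponents gen_fib_eq sum_distrib_left)
  \<comment> \<open>The added indices lie beyond k, where t vanishes.\<close>
  also have "\<dots> = (\<Sum>j=1..n. t j * gen_fib k (n - j) t)"
    using t by (intro sum.mono_neutral_left) (fastforce simp: J_def simp flip: not_le)+
  finally show ?thesis .
qed

text \<open>The divisors of \<open>p ^ n\<close> are the powers \<open>p ^ i\<close> with
  \<open>i \<le> n\<close>. Summation runs over the complementary exponent \<open>j = n - i\<close>,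
  so that j belongs to g, the future inverse, as in the Fibonacci recursion.\<close>

lemma dirichlet_conv_prime_power:
  assumes "prime p"
  shows "dirichlet_conv f g (p ^ n) = (\<Sum>j\<le>n. f (p ^ (n - j)) * g (p ^ j))"
  unfolding dirichlet_conv_def
proof (rule sum.reindex_bij_witness[where i = "\<lambda>j. p ^ (n - j)"
      and j = "\<lambda>d. n - multiplicity p d"])
  have p: "p > 1" using assms by (rule prime_gt_1_nat)
  have *: "p ^ n div p ^ i = p ^ (n - i)" if "i \<le> n" for i
    using that p by (simp add: power_diff)
  fix d assume "d \<in> {d. d dvd p ^ n}"
  then obtain i where i: "i \<le> n" "d = p ^ i"
    using assms by (auto simp: divides_primepow_nat)
  then show "p ^ (n - (n - multiplicity p d)) = d" "n - multiplicity p d \<in> {..n}"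
    "f (p ^ (n - (n - multiplicity p d))) * g (p ^ (n - multiplicity p d)) =
      f d * g (p ^ n div d)"
    using assms * by simp_all
next
  fix j assume "j \<in> {..n}"
  then show "n - multiplicity p (p ^ (n - j)) = j" "p ^ (n - j) \<in> {d. d dvd p ^ n}"
    using assms by (simp_all add: le_imp_power_dvd)
qed

lemma multiplicative_arith_prime_power_rec:
  assumes "prime p" "multiplicative_arith f" "n \<ge> 1"
  shows "f (p ^ n) = (\<Sum>j=1..n. - dirichlet_inv f (p ^ j) * f (p ^ (n - j)))"
proof -
  have f1: "f 1 = 1" using assms(2) by (rule multiplicative_arith_1)
  have "dirichlet_conv f (dirichlet_inv f) 1 = 1"
    using dirichlet_conv_inv[OF assms(2), of 1] by simp
  then have inv1: "dirichlet_inv f 1 = 1"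
    using f1 by (simp add: dirichlet_conv_def)
  \<comment> \<open>Here \<open>p ^ n\<close> differs from 1 because \<open>n \<ge> 1\<close>, so
    the convolution vanishes; the summand \<open>j = 0\<close> is then split off using
    \<open>inv1\<close>.\<close>
  have "0 = (\<Sum>j\<le>n. f (p ^ (n - j)) * dirichlet_inv f (p ^ j))"
    using dirichlet_conv_inv[OF assms(2), of "p ^ n"] dirichlet_conv_prime_power[OF assms(1)]
      assms(3) prime_gt_1_nat[OF assms(1)]
    by simp
  also have "\<dots> = f (p ^ n) + (\<Sum>j=1..n. f (p ^ (n - j)) * dirichlet_inv f (p ^ j))"
    using inv1 by (simp add: atMost_atLeast0 sum.atLeast_Suc_atMost)
  finally show ?thesis
    by (simp add: sum_negf mult.commute eq_neg_iff_add_eq_0)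
qed

theorem theorem1:
  fixes p :: nat and \<chi> :: "nat \<Rightarrow> complex" and k :: enat and t :: "nat \<Rightarrow> complex"
  assumes "prime p"
    and "multiplicative_arith \<chi>"
    and "local_core_params \<chi> p k t"
  shows "\<forall>n. gen_fib k n t = \<chi> (p ^ n)"
proof
  fix n
  have t: "t j = - dirichlet_inv \<chi> (p ^ j)" if "j \<ge> 1" for j
    using assms(3) that by (simp add: local_core_params_def)
  \<comment> \<open>For infinite k the premise is impossible.\<close>
  have t0: "t j = 0" if "k < enat j" for j
    using assms(3) that by (cases k) (auto simp: local_core_params_def)
  show "gen_fib k n t = \<chi> (p ^ n)"
  proof (induction n rule: less_induct)
    case (less n)
    show ?case
    proof (cases "n = 0")
      case True
      then show ?thesis using multiplicative_arith_1[OF assms(2)] by (simp add: gen_fib_def)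
    next
      case False
      then have n: "n \<ge> 1" by simp
      have "gen_fib k n t = (\<Sum>j=1..n. t j * gen_fib k (n - j) t)"
        using n t0 by (rule gen_fib_rec)
      \<comment> \<open>Starting at \<open>j = 1\<close> makes \<open>n - j < n\<close> and avoids
        the unconstrained value \<open>t 0\<close>.\<close>
      also have "\<dots> = (\<Sum>j=1..n. - dirichlet_inv \<chi> (p ^ j) * \<chi> (p ^ (n - j)))"
        using less t by (intro sum.cong) auto
      also have "\<dots> = \<chi> (p ^ n)"
        using multiplicative_arith_prime_power_rec[OF assms(1,2) n] by simp
      finally show ?thesis .
    qed
  qed
qed

end
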